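(* Let $\mu$ be a positive finite Borel measure on $[0,1)$ and let $\mathcal{H}_\mu$ be the associated Hankel operator, with matrix $(\mu_{i+j})_{i,j\ge 0}$, where $\mu_n=\int_0^1t^n\,d\mu(t)$. Suppose that $\mathcal{H}_\mu$ is a bounded operator on $\ell^2$. Then the numerical range satisfies $W(\mathcal{H}_\mu)\subset\{z\in\mathbb{C}:\ \operatorname{Re} z\ge 0\}$. Consequently, the spectrum satisfies $\sigma(\mathcal{H}_\mu)\subset\{z\in\mathbb{C}:\ \operatorname{Re} z\ge 0\}$, and the operator $-\mathcal{H}_\mu$ is the infinitesimal generator of a contraction semigroup.
   Context: $\ell^2=\ell^2(\mathbb{N}_0)$ is the complex Hilbert space of square-summable sequences. For a bounded operator $T$ on a Hilbert space $H$, the numerical range is $W(T)=\{\langle Tx,x\rangle:\ x\in H,\ \|x\|=1\}$. A contraction semigroup is a strongly continuous one-parameter semigroup $(T(s))_{s\ge 0}$ of bounded operators with $\|T(s)\|\le 1$ for all $s\ge 0$. The convention $0^0=1$ is used in $\mu_0=\mu([0,1))$. *)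

theory Defs
  imports "HOL-Analysis.Analysis"
begin

section \<open>The complex Hilbert space of square-summable sequences\<close>

typedef ell2 = "{x :: nat \<Rightarrow> complex. summable (\<lambda>n. (cmod (x n))\<^sup>2)}"
  morphisms coord Abs_ell2
  by (rule exI[of _ "\<lambda>_. 0"]) simp

setup_lifting type_definition_ell2

lemma summable_coord: "summable (\<lambda>n. (cmod (coord x n))\<^sup>2)"
  using coord[of x] by simp

lemma ell2_eqI: "(\<And>n. coord x n = coord y n) \<Longrightarrow> x = y"
  by (metis coord_inject ext)

lemma summable_cmod_sq_add:
  assumes "summable (\<lambda>n. (cmod (x n))\<^sup>2)" "summable (\<lambda>n. (cmod (y n))\<^sup>2)"
  shows "summable (\<lambda>n. (cmod (x n + y n))\<^sup>2)"
proof (rule summable_comparison_test'[where N = 0])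
  show "summable (\<lambda>n. 2 * (cmod (x n))\<^sup>2 + 2 * (cmod (y n))\<^sup>2)"
    by (intro summable_add summable_mult assms)
  fix n :: nat
  have "(cmod (x n + y n))\<^sup>2 \<le> (cmod (x n) + cmod (y n))\<^sup>2"
    by (intro power_mono norm_triangle_ineq) simp
  also have "\<dots> \<le> 2 * (cmod (x n))\<^sup>2 + 2 * (cmod (y n))\<^sup>2"
    using sum_squares_bound[of "cmod (x n)" "cmod (y n)"] by (simp add: power2_sum)
  finally show "norm ((cmod (x n + y n))\<^sup>2) \<le> 2 * (cmod (x n))\<^sup>2 + 2 * (cmod (y n))\<^sup>2"
    by simp
qed

lemma summable_cmod_sq_mult:
  "summable (\<lambda>n. (cmod (x n))\<^sup>2) \<Longrightarrow> summable (\<lambda>n. (cmod (c * x n))\<^sup>2)"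
  by (simp add: norm_mult power_mult_distrib summable_mult)

lift_definition cscale :: "complex \<Rightarrow> ell2 \<Rightarrow> ell2" is "\<lambda>c x n. c * x n"
  by (rule summable_cmod_sq_mult)

lift_definition basis_vec :: "nat \<Rightarrow> ell2" is "\<lambda>k n. if n = k then 1 else 0"
proof -
  fix k
  show "summable (\<lambda>n. (cmod (if n = k then 1 else 0))\<^sup>2)"
    by (rule summable_finite[of "{k}"]) auto
qed

text \<open>The inner product is linear in the first argument.\<close>

definition cinner :: "ell2 \<Rightarrow> ell2 \<Rightarrow> complex" where
  "cinner x y = (\<Sum>n. coord x n * cnj (coord y n))"

lemma summable_cinner: "summable (\<lambda>n. coord x n * cnj (coord y n))"
proof (rule summable_comparison_test'[where N = 0])
  show "summable (\<lambda>n. (cmod (coord x n))\<^sup>2 + (cmod (coord y n))\<^sup>2)"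
    by (intro summable_add summable_coord)
  fix n :: nat
  have "2 * (cmod (coord x n) * cmod (coord y n)) \<le> (cmod (coord x n))\<^sup>2 + (cmod (coord y n))\<^sup>2"
    using sum_squares_bound[of "cmod (coord x n)" "cmod (coord y n)"] by simp
  moreover have "0 \<le> cmod (coord x n) * cmod (coord y n)"
    by simp
  ultimately show "norm (coord x n * cnj (coord y n)) \<le> (cmod (coord x n))\<^sup>2 + (cmod (coord y n))\<^sup>2"
    unfolding norm_mult complex_mod_cnj by linarith
qed

text \<open>
  The underlying real Hilbert space carries the real inner product \<open>Re \<langle>x, y\<rangle>\<close>; its norm is the
  usual norm of \<open>\<ell>\<^sup>2\<close>, see \<open>norm_ell2\<close> below.
\<close>

instantiation ell2 :: real_inner
begin

lift_definition zero_ell2 :: ell2 is "\<lambda>_. 0" by simp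

lift_definition plus_ell2 :: "ell2 \<Rightarrow> ell2 \<Rightarrow> ell2" is "\<lambda>x y n. x n + y n"
  by (rule summable_cmod_sq_add)

lift_definition uminus_ell2 :: "ell2 \<Rightarrow> ell2" is "\<lambda>x n. - x n" by simp

definition minus_ell2 :: "ell2 \<Rightarrow> ell2 \<Rightarrow> ell2" where "minus_ell2 x y = x + - y"

definition scaleR_ell2 :: "real \<Rightarrow> ell2 \<Rightarrow> ell2" where "scaleR_ell2 r = cscale (of_real r)"

definition inner_ell2 :: "ell2 \<Rightarrow> ell2 \<Rightarrow> real" where "inner_ell2 x y = Re (cinner x y)"

definition norm_ell2 :: "ell2 \<Rightarrow> real" where "norm_ell2 x = sqrt (inner x x)"

definition sgn_ell2 :: "ell2 \<Rightarrow> ell2" where "sgn_ell2 x = inverse (norm x) *\<^sub>R x"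

definition dist_ell2 :: "ell2 \<Rightarrow> ell2 \<Rightarrow> real" where "dist_ell2 x y = norm (x - y)"

definition uniformity_ell2 :: "(ell2 \<times> ell2) filter" where
  "uniformity_ell2 = (INF e\<in>{0<..}. principal {(x, y). dist x y < e})"

definition open_ell2 :: "ell2 set \<Rightarrow> bool" where
  "open_ell2 U = (\<forall>x\<in>U. eventually (\<lambda>(x', y). x' = x \<longrightarrow> y \<in> U) uniformity)"

lemma inner_ell2_sums: "(\<lambda>n. Re (coord x n * cnj (coord y n))) sums inner x y"
  unfolding inner_ell2_def cinner_def
  by (rule sums_Re[OF summable_sums[OF summable_cinner]])

instance
proof
  fix x y z :: ell2 and r s :: real
  show "x + y + z = x + (y + z)" "x + y = y + x" "0 + x = x" "- x + x = 0"
    by (transfer, simp add: algebra_simps)+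
  show "x - y = x + - y" by (rule minus_ell2_def)
  show "r *\<^sub>R (x + y) = r *\<^sub>R x + r *\<^sub>R y" "(r + s) *\<^sub>R x = r *\<^sub>R x + s *\<^sub>R x"
    "r *\<^sub>R s *\<^sub>R x = (r * s) *\<^sub>R x" "1 *\<^sub>R x = x"
    unfolding scaleR_ell2_def by (transfer, simp add: algebra_simps)+
  show "sgn x = inverse (norm x) *\<^sub>R x" by (rule sgn_ell2_def)
  show "dist x y = norm (x - y)" by (rule dist_ell2_def)
  show "uniformity = (INF e\<in>{0<..}. principal {(x, y). dist (x::ell2) y < e})"
    by (rule uniformity_ell2_def)
  show "open U = (\<forall>x\<in>U. eventually (\<lambda>(x', y). x' = x \<longrightarrow> y \<in> U) uniformity)"
    for U :: "ell2 set" by (rule open_ell2_def)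
  show "inner x y = inner y x"
  proof (rule sums_unique2[OF inner_ell2_sums])
    have "(\<lambda>n. Re (coord y n * cnj (coord x n))) = (\<lambda>n. Re (coord x n * cnj (coord y n)))"
      by (simp add: algebra_simps)
    then show "(\<lambda>n. Re (coord x n * cnj (coord y n))) sums inner y x"
      using inner_ell2_sums[of y x] by simp
  qed
  have "(\<lambda>n. Re (coord x n * cnj (coord z n)) + Re (coord y n * cnj (coord z n))) sums
      (inner x z + inner y z)"
    by (intro sums_add inner_ell2_sums)
  moreover have "(\<lambda>n. Re (coord x n * cnj (coord z n)) + Re (coord y n * cnj (coord z n))) =
      (\<lambda>n. Re (coord (x + y) n * cnj (coord z n)))"
    by (simp add: plus_ell2.rep_eq algebra_simps)
  ultimately show "inner (x + y) z = inner x z + inner y z"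
    using inner_ell2_sums[of "x + y" z] by (simp add: sums_iff)
  have "(\<lambda>n. r * Re (coord x n * cnj (coord y n))) sums (r * inner x y)"
    by (intro sums_mult inner_ell2_sums)
  moreover have "(\<lambda>n. r * Re (coord x n * cnj (coord y n))) =
      (\<lambda>n. Re (coord (r *\<^sub>R x) n * cnj (coord y n)))"
    by (simp add: scaleR_ell2_def cscale.rep_eq algebra_simps)
  ultimately show "inner (r *\<^sub>R x) y = r * inner x y"
    using inner_ell2_sums[of "r *\<^sub>R x" y] by (simp add: sums_iff)
  have *: "(\<lambda>n. (cmod (coord x n))\<^sup>2) sums inner x x"
    using inner_ell2_sums[of x x] by (simp add: complex_mult_cnj cmod_power2)
  show "0 \<le> inner x x"
    by (rule sums_le[OF _ sums_zero *]) simp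
  show "inner x x = 0 \<longleftrightarrow> x = 0"
  proof
    assume "inner x x = 0"
    with * have "(\<Sum>n. (cmod (coord x n))\<^sup>2) = 0"
      by (simp add: sums_iff)
    then have "(cmod (coord x n))\<^sup>2 = 0" for n
      using suminf_eq_zero_iff[OF summable_coord[of x]] by simp
    then show "x = 0"
      by (intro ell2_eqI) (simp add: zero_ell2.rep_eq)
  next
    assume "x = 0"
    then show "inner x x = 0"
      using * by (simp add: zero_ell2.rep_eq sums_iff)
  qed
  show "norm x = sqrt (inner x x)" by (rule norm_ell2_def)
qed

end

lemma norm_sq_sums: "(\<lambda>n. (cmod (coord x n))\<^sup>2) sums (norm x)\<^sup>2"
proof -
  have "(\<lambda>n. Re (coord x n * cnj (coord x n))) = (\<lambda>n. (cmod (coord x n))\<^sup>2)"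
    by (simp add: complex_mult_cnj cmod_power2)
  then show ?thesis
    using inner_ell2_sums[of x x] by (simp only: power2_norm_eq_inner[of x])
qed

lemma norm_ell2: "norm x = sqrt (\<Sum>n. (cmod (coord x n))\<^sup>2)"
  using norm_sq_sums[of x] by (simp add: sums_iff)

lemma cinner_self: "cinner x x = of_real ((norm x)\<^sup>2)"
proof -
  have "(\<lambda>n. of_real ((cmod (coord x n))\<^sup>2)) sums (of_real ((norm x)\<^sup>2) :: complex)"
    by (intro sums_of_real norm_sq_sums)
  then show ?thesis
    unfolding cinner_def complex_norm_square by (simp add: sums_iff)
qed

lemma coord_diff: "coord (x - y) n = coord x n - coord y n"
  by (simp only: minus_ell2_def plus_ell2.rep_eq uminus_ell2.rep_eq) simp

lemma partial_norm_sq_le: "(\<Sum>n<M. (cmod (coord x n))\<^sup>2) \<le> (norm x)\<^sup>2"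
  using sum_le_suminf[OF summable_coord[of x], of "{..<M}"] norm_sq_sums[of x]
  by (simp add: sums_iff)

lemma cmod_coord_le: "cmod (coord x n) \<le> norm x"
proof (rule power2_le_imp_le)
  have "(cmod (coord x n))\<^sup>2 \<le> (\<Sum>k<Suc n. (cmod (coord x k))\<^sup>2)"
    by (rule member_le_sum) auto
  also have "\<dots> \<le> (norm x)\<^sup>2" by (rule partial_norm_sq_le)
  finally show "(cmod (coord x n))\<^sup>2 \<le> (norm x)\<^sup>2" .
qed simp

instance ell2 :: banach
proof
  fix X :: "nat \<Rightarrow> ell2"
  assume X: "Cauchy X"
  have "\<exists>l. (\<lambda>k. coord (X k) n) \<longlonglongrightarrow> l" for n
  proof -
    have "Cauchy (\<lambda>k. coord (X k) n)"
    proof (rule metric_CauchyI)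
      fix e :: real assume "0 < e"
      then obtain N where N: "\<forall>k\<ge>N. \<forall>m\<ge>N. dist (X k) (X m) < e"
        using metric_CauchyD[OF X, of e] by auto
      have "dist (coord (X k) n) (coord (X m) n) < e" if "k \<ge> N" "m \<ge> N" for k m
        using cmod_coord_le[of "X k - X m" n] N that
        by (force simp: dist_norm coord_diff)
      then show "\<exists>N. \<forall>k\<ge>N. \<forall>m\<ge>N. dist (coord (X k) n) (coord (X m) n) < e" by blast
    qed
    then show ?thesis by (simp add: Cauchy_convergent_iff convergent_def)
  qed
  then obtain l where l: "\<And>n. (\<lambda>k. coord (X k) n) \<longlonglongrightarrow> l n" by metis
  have part: "\<exists>N. \<forall>k\<ge>N. \<forall>M. (\<Sum>n<M. (cmod (coord (X k) n - l n))\<^sup>2) \<le> e\<^sup>2" if "0 < e" for e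
  proof -
    obtain N where N: "\<forall>k\<ge>N. \<forall>m\<ge>N. dist (X k) (X m) < e"
      using metric_CauchyD[OF X \<open>0 < e\<close>] by auto
    have "(\<Sum>n<M. (cmod (coord (X k) n - l n))\<^sup>2) \<le> e\<^sup>2" if "k \<ge> N" for k M
    proof (rule tendsto_upperbound)
      show "(\<lambda>m. \<Sum>n<M. (cmod (coord (X k) n - coord (X m) n))\<^sup>2) \<longlonglongrightarrow>
          (\<Sum>n<M. (cmod (coord (X k) n - l n))\<^sup>2)"
        by (intro tendsto_intros l)
      show "\<forall>\<^sub>F m in sequentially. (\<Sum>n<M. (cmod (coord (X k) n - coord (X m) n))\<^sup>2) \<le> e\<^sup>2"
        unfolding eventually_sequentially
      proof (intro exI allI impI)
        fix m assume "N \<le> m"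
        then have "norm (X k - X m) \<le> e" using N that by (force simp: dist_norm)
        then have "(norm (X k - X m))\<^sup>2 \<le> e\<^sup>2" by (intro power_mono) auto
        then show "(\<Sum>n<M. (cmod (coord (X k) n - coord (X m) n))\<^sup>2) \<le> e\<^sup>2"
          using partial_norm_sq_le[where x = "X k - X m" and M = M] by (simp add: coord_diff)
      qed
    qed simp
    then show ?thesis by blast
  qed
  have sum_diff: "summable (\<lambda>n. (cmod (coord (X k) n - l n))\<^sup>2)"
    if "\<forall>M. (\<Sum>n<M. (cmod (coord (X k) n - l n))\<^sup>2) \<le> B" for k B
    by (rule summableI_nonneg_bounded[where x = B]) (use that in auto)
  obtain N1 where N1: "\<forall>k\<ge>N1. \<forall>M. (\<Sum>n<M. (cmod (coord (X k) n - l n))\<^sup>2) \<le> 1\<^sup>2"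
    using part[of 1] by auto
  have "summable (\<lambda>n. (cmod (coord (X N1) n + (-1) * (coord (X N1) n - l n)))\<^sup>2)"
    using N1 by (intro summable_cmod_sq_add summable_cmod_sq_mult summable_coord sum_diff) blast
  then have "summable (\<lambda>n. (cmod (l n))\<^sup>2)" by simp
  then have L: "coord (Abs_ell2 l) = l" by (simp add: Abs_ell2_inverse)
  have "X \<longlonglongrightarrow> Abs_ell2 l"
  proof (rule metric_LIMSEQ_I)
    fix e :: real assume e: "0 < e"
    obtain N where N: "\<forall>k\<ge>N. \<forall>M. (\<Sum>n<M. (cmod (coord (X k) n - l n))\<^sup>2) \<le> (e/2)\<^sup>2"
      using part[of "e/2"] e by auto
    have "dist (X k) (Abs_ell2 l) < e" if "k \<ge> N" for k
    proof -
      have "(norm (X k - Abs_ell2 l))\<^sup>2 \<le> (e/2)\<^sup>2"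
      proof (rule LIMSEQ_le_const2)
        show "(\<lambda>M. \<Sum>n<M. (cmod (coord (X k) n - l n))\<^sup>2) \<longlonglongrightarrow> (norm (X k - Abs_ell2 l))\<^sup>2"
          using norm_sq_sums[of "X k - Abs_ell2 l"] by (simp only: sums_def coord_diff L)
        show "\<exists>N. \<forall>M\<ge>N. (\<Sum>n<M. (cmod (coord (X k) n - l n))\<^sup>2) \<le> (e/2)\<^sup>2"
          using N that by blast
      qed
      then have "norm (X k - Abs_ell2 l) \<le> e/2"
        by (rule power2_le_imp_le) (use e in simp)
      then show ?thesis using e by (simp add: dist_norm)
    qed
    then show "\<exists>N. \<forall>k\<ge>N. dist (X k) (Abs_ell2 l) < e" by blast
  qed
  then show "convergent X" by (auto simp: convergent_def)
qed

section \<open>Bounded operators, numerical range and spectrum\<close>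

definition bounded_clinear :: "(ell2 \<Rightarrow> ell2) \<Rightarrow> bool" where
  "bounded_clinear T \<longleftrightarrow> bounded_linear T \<and> (\<forall>c x. T (cscale c x) = cscale c (T x))"

definition numerical_range :: "(ell2 \<Rightarrow> ell2) \<Rightarrow> complex set" where
  "numerical_range T = {cinner (T x) x | x. norm x = 1}"

definition spectrum :: "(ell2 \<Rightarrow> ell2) \<Rightarrow> complex set" where
  "spectrum T = {z. \<not> (\<exists>R. bounded_clinear R \<and>
      (\<forall>x. R (T x - cscale z x) = x) \<and> (\<forall>x. T (R x) - cscale z (R x) = x))}"

section \<open>Contraction semigroups\<close>

text \<open>Only the values \<open>S s\<close> for \<open>s \<ge> 0\<close> are relevant.\<close>

definition contraction_semigroup :: "(real \<Rightarrow> ell2 \<Rightarrow> ell2) \<Rightarrow> bool" where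
  "contraction_semigroup S \<longleftrightarrow>
     (\<forall>s\<ge>0. bounded_clinear (S s)) \<and>
     (\<forall>x. S 0 x = x) \<and>
     (\<forall>s\<ge>0. \<forall>t\<ge>0. \<forall>x. S (s + t) x = S s (S t x)) \<and>
     (\<forall>x. continuous_on {0..} (\<lambda>s. S s x)) \<and>
     (\<forall>s\<ge>0. onorm (S s) \<le> 1)"

text \<open>
  A generator is in general only densely defined, so it comes with its domain \<open>D\<close>: the set of all
  vectors whose orbit has a right derivative at \<open>0\<close>. The values of \<open>A\<close> outside \<open>D\<close> are irrelevant.
\<close>

definition infinitesimal_generator ::
    "(real \<Rightarrow> ell2 \<Rightarrow> ell2) \<Rightarrow> ell2 set \<Rightarrow> (ell2 \<Rightarrow> ell2) \<Rightarrow> bool" where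
  "infinitesimal_generator S D A \<longleftrightarrow>
     D = {x. \<exists>y. ((\<lambda>h. (S h x - x) /\<^sub>R h) \<longlongrightarrow> y) (at_right 0)} \<and>
     (\<forall>x\<in>D. ((\<lambda>h. (S h x - x) /\<^sub>R h) \<longlongrightarrow> A x) (at_right 0))"

section \<open>Hankel operators of measures\<close>

definition finite_borel_measure_01 :: "real measure \<Rightarrow> bool" where
  "finite_borel_measure_01 \<mu> \<longleftrightarrow> sets \<mu> = sets (restrict_space borel {0..<1}) \<and> finite_measure \<mu>"

text \<open>For \<open>n = 0\<close> the integrand is \<open>1\<close> everywhere, including at \<open>t = 0\<close>.\<close>

definition moment :: "real measure \<Rightarrow> nat \<Rightarrow> real" where
  "moment \<mu> n = (\<integral>t. t ^ n \<partial>\<mu>)"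

text \<open>
  The bounded operator \<open>T\<close> has matrix \<open>(a i j)\<close> in the standard basis. By \<open>has_matrix_sums\<close> below,
  \<open>T\<close> then acts as \<open>(T x) i = (\<Sum>j. a i j * x j)\<close> with convergent series, so that \<open>T\<close> is determined
  by its matrix.
\<close>

definition has_matrix :: "(ell2 \<Rightarrow> ell2) \<Rightarrow> (nat \<Rightarrow> nat \<Rightarrow> complex) \<Rightarrow> bool" where
  "has_matrix T a \<longleftrightarrow> (\<forall>i j. cinner (T (basis_vec j)) (basis_vec i) = a i j)"

definition hankel_matrix :: "real measure \<Rightarrow> nat \<Rightarrow> nat \<Rightarrow> complex" where
  "hankel_matrix \<mu> i j = of_real (moment \<mu> (i + j))"

lemma cinner_basis_vec: "cinner x (basis_vec i) = coord x i"
proof -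
  have "(\<lambda>n. coord x n * cnj (coord (basis_vec i) n)) sums
      (\<Sum>n\<in>{i}. coord x n * cnj (coord (basis_vec i) n))"
    by (rule sums_finite) (auto simp: basis_vec.rep_eq)
  then show ?thesis by (simp add: cinner_def sums_iff basis_vec.rep_eq)
qed

lemma coord_sum: "coord (sum f A) n = (\<Sum>k\<in>A. coord (f k) n)"
  by (induction A rule: infinite_finite_induct) (auto simp: zero_ell2.rep_eq plus_ell2.rep_eq)

lemma basis_expansion: "(\<lambda>j. cscale (coord x j) (basis_vec j)) sums x"
proof -
  define P where "P M = (\<Sum>j<M. cscale (coord x j) (basis_vec j))" for M
  have coordP: "coord (P M) n = (if n < M then coord x n else 0)" for M n
    by (simp add: P_def coord_sum cscale.rep_eq basis_vec.rep_eq if_distrib[of "(*) _"] cong: if_cong)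
  have "(norm (P M - x))\<^sup>2 = (norm x)\<^sup>2 - (\<Sum>n<M. (cmod (coord x n))\<^sup>2)" for M
  proof -
    have "(\<lambda>n. if n \<in> {..<M} then (cmod (coord x n))\<^sup>2 else 0) sums (\<Sum>n<M. (cmod (coord x n))\<^sup>2)"
      by (rule sums_If_finite_set) simp
    from sums_diff[OF norm_sq_sums[of x] this]
    have "(\<lambda>n. (cmod (coord (P M - x) n))\<^sup>2) sums ((norm x)\<^sup>2 - (\<Sum>n<M. (cmod (coord x n))\<^sup>2))"
      by (rule sums_cong[THEN iffD1, rotated]) (auto simp: coord_diff coordP)
    then show ?thesis by (rule sums_unique2[OF norm_sq_sums])
  qed
  moreover have "(\<lambda>M. (norm x)\<^sup>2 - (\<Sum>n<M. (cmod (coord x n))\<^sup>2)) \<longlonglongrightarrow> (norm x)\<^sup>2 - (norm x)\<^sup>2"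
    by (intro tendsto_diff tendsto_const) (use norm_sq_sums[of x] in \<open>simp add: sums_def\<close>)
  ultimately have "(\<lambda>M. (norm (P M - x))\<^sup>2) \<longlonglongrightarrow> 0" by simp
  from tendsto_real_sqrt[OF this] have "(\<lambda>M. norm (P M - x)) \<longlonglongrightarrow> 0" by simp
  then have "P \<longlonglongrightarrow> x" by (simp add: LIM_zero_iff tendsto_norm_zero_iff)
  then show ?thesis unfolding sums_def P_def .

qed

lemma bounded_linear_coord: "bounded_linear (\<lambda>x. coord x n)"
  by (rule bounded_linear_intro[where K = 1])
     (auto simp: plus_ell2.rep_eq scaleR_ell2_def cscale.rep_eq scaleR_conv_of_real cmod_coord_le)

lemma has_matrix_sums:
  assumes "bounded_clinear T" "has_matrix T a"
  shows "(\<lambda>j. a i j * coord x j) sums coord (T x) i"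
proof -
  have T: "bounded_linear T" and c: "\<And>c x. T (cscale c x) = cscale c (T x)"
    using assms(1) by (auto simp: bounded_clinear_def)
  have "(\<lambda>j. coord (T (cscale (coord x j) (basis_vec j))) i) sums coord (T x) i"
    by (intro bounded_linear.sums[OF bounded_linear_coord] bounded_linear.sums[OF T] basis_expansion)
  moreover have "coord (T (basis_vec j)) i = a i j" for j
    using assms(2) by (simp add: has_matrix_def cinner_basis_vec)
  ultimately show ?thesis by (simp add: c cscale.rep_eq mult.commute)
qed

end

theory Submission
  imports Defs
begin

text \<open>
  For a finitely supported \<open>x\<close> the quadratic form of the Hankel operator is
  \<open>\<integral> |\<Sum>n. x n * t ^ n|\<^sup>2 d\<mu>(t) \<ge> 0\<close>, and boundedness carries positivity over to all of \<open>\<ell>\<^sup>2\<close>. Hence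
  \<open>H - z\<close> is coercive when \<open>Re z < 0\<close>, and is inverted by a Richardson iteration. The orbits
  \<open>u s = exp (- s H) x\<close> satisfy \<open>u' = - H u\<close>, so \<open>|u|\<^sup>2\<close> has derivative \<open>- 2 \<langle>H u, u\<rangle> \<le> 0\<close>; this gives
  contractivity and, applied to differences of solutions, uniqueness and thus the semigroup law.
\<close>

section \<open>Positivity of the Hankel form\<close>

text \<open>Powers are bounded by 1 on [0,1) and the measure is finite.\<close>

lemma finite_borel_measure_01_integrable_power:
  assumes "finite_borel_measure_01 \<mu>"
  shows "integrable \<mu> (\<lambda>t. t ^ n)"
proof -
  have S: "sets \<mu> = sets (restrict_space borel {0..<1})" and "finite_measure \<mu>"
    using assms by (auto simp: finite_borel_measure_01_def)
  interpret finite_measure \<mu> by fact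
  have space: "space \<mu> = {0..<1}"
    using sets_eq_imp_space_eq[OF S] by (simp add: space_restrict_space)
  have "(\<lambda>t::real. t ^ n) \<in> borel_measurable (restrict_space borel {0..<1})"
    by (intro measurable_restrict_space1) measurable
  then have "(\<lambda>t::real. t ^ n) \<in> borel_measurable \<mu>"
    using measurable_cong_sets[OF S refl] by blast
  then show ?thesis
    by (intro integrable_const_bound[where B = 1]) (auto simp: space power_le_one)
qed

text \<open>Since t^(i+j) = t^i t^j, the double sum under the integral is the squared modulus of the
  polynomial with coefficients \<open>x i\<close>.\<close>

lemma Re_hankel_form_nonneg:
  assumes "finite_borel_measure_01 \<mu>"
  shows "0 \<le> Re (\<Sum>i<M. (\<Sum>j<M. hankel_matrix \<mu> i j * x j) * cnj (x i))"
proof -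
  have Re_of_real_mult: "Re (of_real r * z) = r * Re z" for r z
    by simp
  have "Re (\<Sum>i<M. (\<Sum>j<M. hankel_matrix \<mu> i j * x j) * cnj (x i))
      = (\<Sum>i<M. \<Sum>j<M. (\<integral>t. t ^ (i + j) * Re (x j * cnj (x i)) \<partial>\<mu>))"
    by (simp add: sum_distrib_right hankel_matrix_def moment_def mult.assoc
        Re_of_real_mult del: times_complex.simps)
  also have "\<dots> = (\<integral>t. (\<Sum>i<M. \<Sum>j<M. t ^ (i + j) * Re (x j * cnj (x i))) \<partial>\<mu>)"
    using finite_borel_measure_01_integrable_power[OF assms] by simp
  also have "\<dots> = (\<integral>t. (cmod (\<Sum>i<M. of_real (t ^ i) * x i))\<^sup>2 \<partial>\<mu>)"
  proof (rule arg_cong[where f = "integral\<^sup>L \<mu>"], rule ext)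
    fix t
    define p where "p = (\<Sum>i<M. of_real (t ^ i) * x i)"
    have "(cmod p)\<^sup>2 = Re (cnj p * p)"
      by (metis Re_complex_of_real complex_norm_square mult.commute)
    also have "cnj p * p = (\<Sum>i<M. \<Sum>j<M. of_real (t ^ (i + j)) * (x j * cnj (x i)))"
      unfolding p_def cnj_sum sum_product by (simp add: power_add mult_ac)
    finally show "(\<Sum>i<M. \<Sum>j<M. t ^ (i + j) * Re (x j * cnj (x i)))
        = (cmod (\<Sum>i<M. of_real (t ^ i) * x i))\<^sup>2"
      by (simp add: p_def Re_of_real_mult del: times_complex.simps of_real_power)
  qed
  also have "0 \<le> \<dots>" by (rule Bochner_Integration.integral_nonneg) simp
  finally show ?thesis .
qed

text \<open>The truncations \<open>P M\<close> converge to \<open>x\<close>, the form is nonnegative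
  on each of them, and continuity of \<open>H\<close> and of the inner product passes this to the
  limit.\<close>

lemma inner_hankel_nonneg:
  assumes \<mu>: "finite_borel_measure_01 \<mu>"
    and H: "bounded_clinear H" "has_matrix H (hankel_matrix \<mu>)"
  shows "0 \<le> inner (H x) x"
proof -
  interpret bounded_linear H using H(1) by (simp add: bounded_clinear_def)
  define P where "P M = (\<Sum>j<M. cscale (coord x j) (basis_vec j))" for M
  have coordP: "coord (P M) n = (if n < M then coord x n else 0)" for M n
    by (simp add: P_def coord_sum cscale.rep_eq basis_vec.rep_eq if_distrib[of "(*) _"] cong: if_cong)
  \<comment> \<open>\<open>P M\<close> has finite support, so the matrix series is a finite
    sum.\<close>
  have coordH: "coord (H (P M)) i = (\<Sum>j<M. hankel_matrix \<mu> i j * coord x j)" for M i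
  proof -
    have "(\<lambda>j. hankel_matrix \<mu> i j * coord (P M) j) sums
        (\<Sum>j<M. hankel_matrix \<mu> i j * coord (P M) j)"
      by (rule sums_finite) (auto simp: coordP)
    from sums_unique2[OF has_matrix_sums[OF H] this] show ?thesis by (simp add: coordP)
  qed
  have "cinner (H (P M)) (P M) =
      (\<Sum>i<M. (\<Sum>j<M. hankel_matrix \<mu> i j * coord x j) * cnj (coord x i))" for M
  proof -
    have "(\<lambda>i. coord (H (P M)) i * cnj (coord (P M) i)) sums
        (\<Sum>i<M. coord (H (P M)) i * cnj (coord (P M) i))"
      by (rule sums_finite) (auto simp: coordP)
    then show ?thesis by (simp add: cinner_def sums_iff coordP coordH)
  qed
  then have "0 \<le> inner (H (P M)) (P M)" for M
    using Re_hankel_form_nonneg[OF \<mu>] by (simp add: inner_ell2_def)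
  moreover have "P \<longlonglongrightarrow> x"
    using basis_expansion[of x] by (simp add: sums_def P_def[abs_def])
  then have "(\<lambda>M. inner (H (P M)) (P M)) \<longlonglongrightarrow> inner (H x) x"
    by (intro tendsto_inner tendsto)
  ultimately show ?thesis
    by (intro LIMSEQ_le_const) auto
qed

section \<open>Coercive operators\<close>

lemma coercive_norm_le:
  fixes A :: "'a::real_inner \<Rightarrow> 'a"
  assumes "\<And>x. c * (norm x)\<^sup>2 \<le> inner (A x) x"
  shows "c * norm x \<le> norm (A x)"
proof (cases "x = 0")
  case False
  have "c * norm x * norm x \<le> norm (A x) * norm x"
    using assms[of x] norm_cauchy_schwarz[of "A x" x] by (simp add: power2_eq_square mult.assoc)
  with False show ?thesis by simp
qed simp

text \<open>\<open>A x = y\<close> says that \<open>x\<close> is a fixed point of the map sending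
  \<open>x\<close> to \<open>x - t *\<^sub>R A x + t *\<^sub>R y\<close>, and for a suitable
  \<open>t > 0\<close> this map is a strict contraction.\<close>

lemma coercive_surj:
  fixes A :: "'a::{real_inner,banach} \<Rightarrow> 'a"
  assumes "bounded_linear A" and c: "0 < c" and coercive: "\<And>x. c * (norm x)\<^sup>2 \<le> inner (A x) x"
  shows "surj A"
proof -
  interpret bounded_linear A by fact
  obtain K0 where K0: "\<And>x. norm (A x) \<le> norm x * K0"
    using bounded by blast
  \<comment> \<open>The maximum keeps \<open>K\<close> positive and at least \<open>c\<close>, so
    that the number under the root in \<open>q\<close> is nonnegative.\<close>
  define K where "K = max K0 c"
  have "c \<le> K" "0 < K" using c by (auto simp: K_def)
  have K: "norm (A x) \<le> K * norm x" for x
    using K0[of x] mult_left_mono[of K0 K "norm x"] by (simp add: K_def mult.commute)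
  \<comment> \<open>Expanding the squared norm below gives the factor
    \<open>1 - 2*t*c + t^2*K^2\<close>; this \<open>t\<close> minimises it, and the minimum is
    \<open>q^2\<close>.\<close>
  define t where "t = c / K\<^sup>2"
  define q where "q = sqrt (1 - c\<^sup>2 / K\<^sup>2)"
  have "t > 0" using c \<open>0 < K\<close> by (simp add: t_def)
  have r: "0 \<le> 1 - c\<^sup>2 / K\<^sup>2" "1 - c\<^sup>2 / K\<^sup>2 < 1"
    using c \<open>0 < K\<close> \<open>c \<le> K\<close> by (auto simp: divide_simps power_mono)
  have q: "0 \<le> q" "q < 1" using r by (auto simp: q_def)
  have contr: "norm (x - t *\<^sub>R A x) \<le> q * norm x" for x
  proof (rule power2_le_imp_le)
    have "(norm (x - t *\<^sub>R A x))\<^sup>2 = (norm x)\<^sup>2 - 2 * t * inner (A x) x + t\<^sup>2 * (norm (A x))\<^sup>2"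
      unfolding power2_norm_eq_inner
      by (simp add: inner_diff_left inner_diff_right inner_commute power2_eq_square algebra_simps)
    also have "\<dots> \<le> (norm x)\<^sup>2 - 2 * t * (c * (norm x)\<^sup>2) + t\<^sup>2 * (K * norm x)\<^sup>2"
      using \<open>t > 0\<close> coercive[of x] K[of x]
      by (intro add_mono diff_mono mult_left_mono power_mono) auto
    also have "\<dots> = (1 - c\<^sup>2 / K\<^sup>2) * (norm x)\<^sup>2"
      using \<open>0 < K\<close> by (simp add: t_def field_simps power2_eq_square)
    also have "\<dots> = (q * norm x)\<^sup>2"
      using r by (simp add: q_def power_mult_distrib)
    finally show "(norm (x - t *\<^sub>R A x))\<^sup>2 \<le> (q * norm x)\<^sup>2" .
  qed (use q in simp)
  have "\<exists>x. A x = y" for y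
  proof -
    have "\<exists>!x. x - t *\<^sub>R A x + t *\<^sub>R y = x"
    proof (rule banach_fix_type[OF q], intro allI)
      fix x z
      have "norm ((x - z) - t *\<^sub>R A (x - z)) \<le> q * norm (x - z)" by (rule contr)
      then show "dist (x - t *\<^sub>R A x + t *\<^sub>R y) (z - t *\<^sub>R A z + t *\<^sub>R y) \<le> q * dist x z"
        by (simp add: dist_norm diff algebra_simps)
    qed
    then obtain x where "x - t *\<^sub>R A x + t *\<^sub>R y = x" by blast
    then have "t *\<^sub>R y = t *\<^sub>R A x" by simp
    with \<open>t > 0\<close> show ?thesis by auto
  qed
  then show ?thesis unfolding surj_def by metis
qed

section \<open>Complex scalars and bounded inverses\<close>

lemma cscale_of_real: "cscale (of_real r) x = r *\<^sub>R x"
  by (simp add: scaleR_ell2_def)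

text \<open>\<open>cinner x x\<close> is real, so only \<open>Re z\<close> survives. This turns a
  shift by \<open>z\<close> with \<open>Re z < 0\<close> into coercivity.\<close>

lemma inner_cscale_self: "inner (cscale z x) x = Re z * (norm x)\<^sup>2"
proof -
  have "cinner (cscale z x) x = z * cinner x x"
    unfolding cinner_def suminf_mult[OF summable_cinner, symmetric]
    by (simp add: cscale.rep_eq mult.assoc)
  then show ?thesis by (simp add: inner_ell2_def cinner_self)
qed

lemma norm_cscale: "norm (cscale z x) = cmod z * norm x"
proof -
  have "(\<lambda>n. (cmod z)\<^sup>2 * (cmod (coord x n))\<^sup>2) sums ((cmod z)\<^sup>2 * (norm x)\<^sup>2)"
    by (intro sums_mult norm_sq_sums)
  then have "(norm (cscale z x))\<^sup>2 = (cmod z * norm x)\<^sup>2"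
    using norm_sq_sums[of "cscale z x"]
    by (simp add: cscale.rep_eq norm_mult power_mult_distrib sums_iff)
  then show ?thesis by (simp add: power2_eq_iff_nonneg)
qed

lemma cscale_add: "cscale z (x + y) = cscale z x + cscale z y"
  by transfer (simp add: algebra_simps)

lemma cscale_cscale: "cscale w (cscale z x) = cscale (w * z) x"
  by transfer (simp add: algebra_simps)

lemma bounded_clinear_cscale: "bounded_clinear (cscale z)"
proof -
  have "bounded_linear (cscale z)"
    by (rule bounded_linear_intro[where K = "cmod z"])
       (simp_all add: cscale_add norm_cscale cscale_cscale mult.commute flip: cscale_of_real)
  then show ?thesis by (simp add: bounded_clinear_def cscale_cscale mult.commute)
qed

lemma cscale_diff: "cscale z (x - y) = cscale z x - cscale z y"
  using bounded_clinear_cscale[of z]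
  by (simp add: bounded_clinear_def linear_diff bounded_linear.linear)

text \<open>The lower bound \<open>c * norm x \<le> norm (A x)\<close> gives injectivity and bounds
  the inverse by \<open>1 / c\<close>; linearity passes from \<open>A\<close> to its
  inverse.\<close>

lemma coercive_bounded_clinear_inverse:
  assumes A: "bounded_clinear A" and c: "0 < c"
    and coercive: "\<And>x. c * (norm x)\<^sup>2 \<le> inner (A x) x"
  shows "\<exists>R. bounded_clinear R \<and> (\<forall>x. R (A x) = x) \<and> (\<forall>x. A (R x) = x)"
proof -
  interpret bounded_linear A using A by (simp add: bounded_clinear_def)
  have bound: "c * norm x \<le> norm (A x)" for x
    using coercive by (rule coercive_norm_le)
  have "surj A"
    using bounded_linear_axioms c coercive by (rule coercive_surj)
  have "inj A"
  proof (rule injI)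
    fix x y assume "A x = A y"
    then have "c * norm (x - y) \<le> 0" using bound[of "x - y"] by (simp add: diff)
    with c show "x = y" by (simp add: mult_le_0_iff)
  qed
  define R where "R = inv A"
  have AR: "A (R y) = y" for y
    unfolding R_def using \<open>surj A\<close> by (rule surj_f_inv_f)
  have RA: "R (A x) = x" for x
    unfolding R_def using \<open>inj A\<close> by (rule inv_f_f)
  have Rscale: "R (cscale z x) = cscale z (R x)" for z x
    using A by (metis AR RA bounded_clinear_def)
  have "bounded_linear R"
  proof (rule bounded_linear_intro[where K = "1 / c"])
    show "R (x + y) = R x + R y" for x y by (metis AR RA add)
    show "R (r *\<^sub>R x) = r *\<^sub>R R x" for r x by (metis AR RA scaleR)
    show "norm (R x) \<le> norm x * (1 / c)" for x
      using bound[of "R x"] c by (simp add: AR field_simps)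
  qed
  with AR RA Rscale show ?thesis by (auto simp: bounded_clinear_def)
qed

text \<open>For \<open>Re z < 0\<close> the shifted operator is coercive with constant
  \<open>- Re z\<close>, hence boundedly invertible.\<close>

lemma spectrum_accretive:
  assumes T: "bounded_clinear T" and acc: "\<And>x. 0 \<le> inner (T x) x"
  shows "spectrum T \<subseteq> {z. Re z \<ge> 0}"
proof (rule ccontr)
  assume "\<not> ?thesis"
  then obtain z where z: "z \<in> spectrum T" "Re z < 0" by force
  have "bounded_clinear (\<lambda>x. T x - cscale z x)"
    using T bounded_clinear_cscale[of z]
    by (auto simp: bounded_clinear_def cscale_diff intro: bounded_linear_sub)
  moreover have "- Re z * (norm x)\<^sup>2 \<le> inner (T x - cscale z x) x" for x
    using acc[of x] by (simp add: inner_diff_left inner_cscale_self)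
  ultimately have "z \<notin> spectrum T"
    using coercive_bounded_clinear_inverse[of "\<lambda>x. T x - cscale z x" "- Re z"] z(2)
    by (simp add: spectrum_def)
  with z(1) show False by contradiction
qed

section \<open>The exponential of a bounded operator\<close>

text \<open>The exponential series of \<open>s A\<close>, applied to a single vector so that
  convergence takes place in the space itself and not in an operator algebra.\<close>

definition exp_orbit :: "('a \<Rightarrow> 'a) \<Rightarrow> real \<Rightarrow> 'a \<Rightarrow> 'a::real_normed_vector" where
  "exp_orbit A s x = (\<Sum>n. (s ^ n / fact n) *\<^sub>R (A ^^ n) x)"

lemma bounded_linear_funpow:
  fixes A :: "'a::real_normed_vector \<Rightarrow> 'a"
  assumes "bounded_linear A"
  shows "bounded_linear (A ^^ n)"
proof (induction n)
  case (Suc n)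
  then show ?case using bounded_linear_compose[OF assms Suc] by (simp add: comp_def)
qed (simp add: id_def)

lemma norm_funpow_le:
  fixes A :: "'a::real_normed_vector \<Rightarrow> 'a"
  assumes "\<And>x. norm (A x) \<le> K * norm x" "0 \<le> K"
  shows "norm ((A ^^ n) x) \<le> K ^ n * norm x"
proof (induction n)
  case (Suc n)
  have "norm ((A ^^ Suc n) x) \<le> K * norm ((A ^^ n) x)" using assms(1) by simp
  also have "\<dots> \<le> K * (K ^ n * norm x)" using Suc assms(2) by (rule mult_left_mono)
  finally show ?case by (simp add: mult.assoc)
qed simp

lemma bounded_linear_bound_mult:
  assumes "bounded_linear A"
  obtains K where "0 \<le> K" "\<And>x. norm (A x) \<le> K * norm x"
  using bounded_linear.nonneg_bounded[OF assms] by (metis mult.commute)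

text \<open>Terms of \<open>B * exp (r * K)\<close>: the scalar majorant for the exponential series
  and for its termwise derivative.\<close>

lemma summable_exp_terms: "summable (\<lambda>n. r ^ n * K ^ n * B / fact n :: real)"
  using summable_mult[OF summable_exp[of "r * K"], of B]
  by (simp add: power_mult_distrib field_simps)

lemma norm_exp_term_le:
  fixes A :: "'a::real_normed_vector \<Rightarrow> 'a"
  assumes "\<And>x. norm (A x) \<le> K * norm x" "0 \<le> K" "\<bar>s\<bar> \<le> r"
  shows "norm ((s ^ n / fact n) *\<^sub>R (A ^^ n) x) \<le> r ^ n * K ^ n * norm x / fact n"
proof -
  have "\<bar>s\<bar> ^ n * norm ((A ^^ n) x) \<le> r ^ n * (K ^ n * norm x)"
    using assms norm_funpow_le[of A K n x] by (intro mult_mono power_mono) auto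
  then show ?thesis by (simp add: power_abs divide_right_mono mult.assoc)
qed

lemma exp_orbit_sums:
  fixes A :: "'a::banach \<Rightarrow> 'a"
  assumes "bounded_linear A"
  shows "(\<lambda>n. (s ^ n / fact n) *\<^sub>R (A ^^ n) x) sums exp_orbit A s x"
proof -
  obtain K where K: "0 \<le> K" "\<And>x. norm (A x) \<le> K * norm x"
    using bounded_linear_bound_mult[OF assms] by blast
  have "summable (\<lambda>n. (s ^ n / fact n) *\<^sub>R (A ^^ n) x)"
    by (rule summable_comparison_test'[OF summable_exp_terms norm_exp_term_le[OF K(2,1) order_refl]])
  then show ?thesis unfolding exp_orbit_def by (rule summable_sums)
qed

lemma exp_orbit_0 [simp]: "exp_orbit A 0 x = x"
proof -
  have "(\<lambda>n. (0 ^ n / fact n) *\<^sub>R (A ^^ n) x) sums (\<Sum>n\<in>{0}. (0 ^ n / fact n) *\<^sub>R (A ^^ n) x)"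
    by (rule sums_finite) auto
  then show ?thesis by (simp add: exp_orbit_def sums_iff)
qed

text \<open>\<open>B\<close> commutes with all powers of \<open>A\<close>, and its continuity
  carries it through the series. With \<open>B\<close> a complex scaling this yields complex
  linearity of the semigroup.\<close>

lemma exp_orbit_commute:
  fixes A B :: "'a::banach \<Rightarrow> 'a"
  assumes A: "bounded_linear A" and B: "bounded_linear B" and AB: "\<And>x. A (B x) = B (A x)"
  shows "exp_orbit A s (B x) = B (exp_orbit A s x)"
proof -
  have *: "(A ^^ n) (B x) = B ((A ^^ n) x)" for n
    by (induction n) (simp_all add: AB)
  have "(\<lambda>n. B ((s ^ n / fact n) *\<^sub>R (A ^^ n) x)) sums B (exp_orbit A s x)"
    by (intro bounded_linear.sums[OF B] exp_orbit_sums A)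
  then have "(\<lambda>n. (s ^ n / fact n) *\<^sub>R (A ^^ n) (B x)) sums B (exp_orbit A s x)"
    by (simp add: * linear_scale bounded_linear.linear[OF B])
  from sums_unique2[OF exp_orbit_sums[OF A] this] show ?thesis .
qed

lemma exp_orbit_add:
  fixes A :: "'a::banach \<Rightarrow> 'a"
  assumes "bounded_linear A"
  shows "exp_orbit A s (x + y) = exp_orbit A s x + exp_orbit A s y"
proof -
  have "(A ^^ n) (x + y) = (A ^^ n) x + (A ^^ n) y" for n
    using bounded_linear_funpow[OF assms] by (simp add: linear_add bounded_linear.linear)
  then have "(\<lambda>n. (s ^ n / fact n) *\<^sub>R (A ^^ n) (x + y)) sums (exp_orbit A s x + exp_orbit A s y)"
    using sums_add[OF exp_orbit_sums[OF assms, of s x] exp_orbit_sums[OF assms, of s y]]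
    by (simp add: scaleR_add_right)
  from sums_unique2[OF exp_orbit_sums[OF assms] this] show ?thesis .
qed

text \<open>The series may be differentiated term by term: the derivatives are \<open>A\<close>
  applied to the terms shifted by one index, and they converge uniformly for bounded times.\<close>

lemma exp_orbit_has_vector_derivative:
  fixes A :: "'a::banach \<Rightarrow> 'a"
  assumes A: "bounded_linear A"
  shows "((\<lambda>s. exp_orbit A s x) has_vector_derivative A (exp_orbit A s x)) (at s)"
proof -
  obtain K where K: "0 \<le> K" "\<And>x. norm (A x) \<le> K * norm x"
    using bounded_linear_bound_mult[OF A] by blast
  \<comment> \<open>The interval \<open>S\<close> is bounded, for a uniform majorant, and open, for
    a two-sided derivative at \<open>s\<close>.\<close>
  define r where "r = \<bar>s\<bar> + 1"
  define S where "S = ball (0::real) r"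
  have s: "s \<in> S" by (simp add: S_def r_def)
  define f where "f n t = (t ^ n / fact n) *\<^sub>R (A ^^ n) x" for n t
  \<comment> \<open>At \<open>n = 0\<close> the truncated exponent \<open>n - 1\<close> is harmless:
    the factor \<open>of_nat n\<close> makes the term vanish.\<close>
  define f' where "f' n t = (of_nat n * t ^ (n - 1) / fact n) *\<^sub>R (A ^^ n) x" for n t
  have f'_Suc: "f' (Suc n) t = A (f n t)" for n t
    by (simp add: f_def f'_def linear_scale bounded_linear.linear[OF A])
  have unif: "uniform_limit S (\<lambda>n t. \<Sum>i<n. f' i t) (\<lambda>t. A (exp_orbit A t x)) sequentially"
  proof -
    \<comment> \<open>The majorant is shifted by one index to match \<open>f'_Suc\<close>.\<close>
    have "norm (f' n t) \<le> (case n of 0 \<Rightarrow> 0 | Suc m \<Rightarrow> K * (r ^ m * K ^ m * norm x / fact m))"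
      if "t \<in> S" for n t
    proof (cases n)
      case 0
      then show ?thesis by (simp add: f'_def)
    next
      case (Suc m)
      have "norm (A (f m t)) \<le> K * norm (f m t)" by (rule K)
      also have "\<dots> \<le> K * (r ^ m * K ^ m * norm x / fact m)"
        unfolding f_def using that by (intro mult_left_mono norm_exp_term_le K) (auto simp: S_def)
      finally show ?thesis by (simp add: Suc f'_Suc)
    qed
    moreover have "summable (\<lambda>n. case n of 0 \<Rightarrow> 0 | Suc m \<Rightarrow> K * (r ^ m * K ^ m * norm x / fact m))"
      by (subst summable_Suc_iff[symmetric]) (simp only: nat.case summable_mult summable_exp_terms)
    ultimately have "uniform_limit S (\<lambda>n t. \<Sum>i<n. f' i t) (\<lambda>t. suminf (\<lambda>i. f' i t)) sequentially"
      by (rule Weierstrass_m_test)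
    moreover have "suminf (\<lambda>i. f' i t) = A (exp_orbit A t x)" for t
    proof -
      have "(\<lambda>n. f' (Suc n) t) sums A (exp_orbit A t x)"
        unfolding f'_Suc f_def by (intro bounded_linear.sums[OF A] exp_orbit_sums A)
      then have "(\<lambda>n. f' n t) sums (A (exp_orbit A t x) + f' 0 t)"
        by (rule sums_Suc)
      then show ?thesis by (simp add: f'_def sums_iff)
    qed
    ultimately show ?thesis by simp
  qed
  have "\<exists>g. \<forall>t\<in>S. (\<lambda>n. f n t) sums g t \<and>
      (g has_derivative (\<lambda>h. h *\<^sub>R A (exp_orbit A t x))) (at t within S)"
  proof (rule has_derivative_series[where f = f and f' = "\<lambda>n t h. h *\<^sub>R f' n t" and x = s])
    show "convex S" by (simp add: S_def)
    show "(f n has_derivative (\<lambda>h. h *\<^sub>R f' n t)) (at t within S)" for n t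
      unfolding f_def f'_def
      by (auto intro!: derivative_eq_intros simp: field_simps)
    show "\<forall>\<^sub>F n in sequentially. \<forall>t\<in>S. \<forall>h.
        norm ((\<Sum>i<n. h *\<^sub>R f' i t) - h *\<^sub>R A (exp_orbit A t x)) \<le> e * norm h" if "0 < e" for e
    proof -
      have "\<forall>\<^sub>F n in sequentially. \<forall>t\<in>S. dist (\<Sum>i<n. f' i t) (A (exp_orbit A t x)) < e"
        using unif \<open>0 < e\<close> by (rule uniform_limitD)
      then show ?thesis
      proof eventually_elim
        case (elim n)
        show ?case
        proof (intro ballI allI)
          fix t h assume "t \<in> S"
          with elim have "norm ((\<Sum>i<n. f' i t) - A (exp_orbit A t x)) \<le> e"
            by (force simp: dist_norm)
          then have "\<bar>h\<bar> * norm ((\<Sum>i<n. f' i t) - A (exp_orbit A t x)) \<le> \<bar>h\<bar> * e"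
            by (rule mult_left_mono) simp
          then show "norm ((\<Sum>i<n. h *\<^sub>R f' i t) - h *\<^sub>R A (exp_orbit A t x)) \<le> e * norm h"
            by (simp add: mult.commute flip: scaleR_sum_right scaleR_diff_right)
        qed
      qed
    qed
    show "s \<in> S" by fact
    show "(\<lambda>n. f n s) sums exp_orbit A s x"
      unfolding f_def by (intro exp_orbit_sums A)
  qed
  then obtain g where g: "\<And>t. t \<in> S \<Longrightarrow> (\<lambda>n. f n t) sums g t"
    "(g has_derivative (\<lambda>h. h *\<^sub>R A (exp_orbit A s x))) (at s within S)"
    using s by blast
  have "open S" by (simp add: S_def)
  \<comment> \<open>The series theorem only provides some sum function \<open>g\<close>; uniqueness
    of limits identifies it on \<open>S\<close>.\<close>
  have "g t = exp_orbit A t x" if "t \<in> S" for t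
    using sums_unique2[OF g(1)[OF that]] exp_orbit_sums[OF A] by (simp add: f_def)
  with g(2) have "((\<lambda>t. exp_orbit A t x) has_derivative (\<lambda>h. h *\<^sub>R A (exp_orbit A s x))) (at s within S)"
    using s has_derivative_transform by metis
  then show ?thesis
    unfolding has_vector_derivative_def at_within_open[OF s \<open>open S\<close>] .
qed

section \<open>Accretive operators generate contraction semigroups\<close>

text \<open>Energy estimate: accretivity makes the derivative of the squared norm nonpositive along
  a solution.\<close>

lemma accretive_solution_norm_le:
  fixes u :: "real \<Rightarrow> 'a::real_inner"
  assumes u: "\<And>s. (u has_vector_derivative - T (u s)) (at s)"
    and acc: "\<And>x. 0 \<le> inner (T x) x" and "0 \<le> s"
  shows "norm (u s) \<le> norm (u 0)"
proof -
  have "((\<lambda>s. inner (u s) (u s)) has_real_derivative - 2 * inner (T (u s)) (u s)) (at s)" for s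
  proof -
    have "((\<lambda>s. inner (u s) (u s)) has_derivative
        (\<lambda>h. inner (u s) (h *\<^sub>R - T (u s)) + inner (h *\<^sub>R - T (u s)) (u s))) (at s)"
      using u[of s] unfolding has_vector_derivative_def by (intro has_derivative_inner)
    then show ?thesis
      unfolding has_field_derivative_def
      by (rule has_derivative_eq_rhs) (auto simp: inner_commute)
  qed
  then have "inner (u s) (u s) \<le> inner (u 0) (u 0)"
    using acc \<open>0 \<le> s\<close>
    by (intro DERIV_nonpos_imp_nonincreasing[of 0 s "\<lambda>s. inner (u s) (u s)"]) force+
  then show ?thesis by (simp add: norm_eq_sqrt_inner)
qed

text \<open>By linearity the difference of two solutions is a solution. It starts at 0 and its norm
  cannot grow.\<close>

lemma accretive_solution_unique:
  fixes u v :: "real \<Rightarrow> 'a::real_inner"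
  assumes T: "linear T" and acc: "\<And>x. 0 \<le> inner (T x) x"
    and u: "\<And>s. (u has_vector_derivative - T (u s)) (at s)"
    and v: "\<And>s. (v has_vector_derivative - T (v s)) (at s)"
    and "u 0 = v 0" "0 \<le> s"
  shows "u s = v s"
proof -
  have "norm (u s - v s) \<le> norm (u 0 - v 0)"
  proof (rule accretive_solution_norm_le[OF _ acc \<open>0 \<le> s\<close>])
    show "((\<lambda>s. u s - v s) has_vector_derivative - T (u s - v s)) (at s)" for s
      using has_vector_derivative_diff[OF u v, of s] by (simp add: linear_diff[OF T])
  qed
  with \<open>u 0 = v 0\<close> show ?thesis by simp
qed

lemma contraction_semigroup_exp_orbit:
  assumes T: "bounded_clinear T" and acc: "\<And>x. 0 \<le> inner (T x) x"
  shows "contraction_semigroup (exp_orbit (\<lambda>x. - T x))"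
proof -
  define A where "A x = - T x" for x
  have blT: "bounded_linear T" and cT: "\<And>c x. T (cscale c x) = cscale c (T x)"
    using T by (auto simp: bounded_clinear_def)
  have A: "bounded_linear A" unfolding A_def by (intro bounded_linear_minus blT)
  have deriv: "((\<lambda>s. exp_orbit A s x) has_vector_derivative - T (exp_orbit A s x)) (at s)" for x s
    using exp_orbit_has_vector_derivative[OF A] by (simp add: A_def)
  have contr: "norm (exp_orbit A s x) \<le> norm x" if "0 \<le> s" for s x
    using accretive_solution_norm_le[OF deriv acc that] by simp
  have scale: "exp_orbit A s (cscale c x) = cscale c (exp_orbit A s x)" for s c x
  proof (rule exp_orbit_commute[OF A])
    show "bounded_linear (cscale c)"
      using bounded_clinear_cscale by (simp add: bounded_clinear_def)
    then show "A (cscale c x) = cscale c (A x)" for x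
      by (simp add: A_def cT linear_neg bounded_linear.linear)
  qed
  have "bounded_clinear (exp_orbit A s)" if "0 \<le> s" for s
  proof -
    have "bounded_linear (exp_orbit A s)"
      by (rule bounded_linear_intro[where K = 1])
        (simp_all add: exp_orbit_add[OF A] scale contr[OF that] flip: cscale_of_real)
    then show ?thesis by (simp add: bounded_clinear_def scale)
  qed
  moreover have "exp_orbit A (s + t) x = exp_orbit A s (exp_orbit A t x)" if "0 \<le> s" for s t x
  \<comment> \<open>As functions of \<open>s\<close>, both sides solve \<open>u' = - T u\<close>,
    and at \<open>s = 0\<close> both equal \<open>exp_orbit A t x\<close>.\<close>
  proof (rule accretive_solution_unique[where T = T and u = "\<lambda>s. exp_orbit A (s + t) x"])
    show "((\<lambda>s. exp_orbit A (s + t) x) has_vector_derivative - T (exp_orbit A (s + t) x)) (at s)" for s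
    proof -
      have "((\<lambda>s. s + t) has_vector_derivative 1) (at s)"
        by (auto intro!: derivative_eq_intros)
      from vector_diff_chain_at[OF this deriv[of x "s + t"]] show ?thesis by (simp add: comp_def)
    qed
  qed (use acc deriv that blT in \<open>auto simp: bounded_linear.linear\<close>)
  moreover have "continuous_on {0..} (\<lambda>s. exp_orbit A s x)" for x
    using deriv by (intro continuous_at_imp_continuous_on) (blast intro: has_vector_derivative_continuous)
  moreover have "onorm (exp_orbit A s) \<le> 1" if "0 \<le> s" for s
    using contr[OF that] by (intro onorm_bound) auto
  ultimately have "contraction_semigroup (exp_orbit A)"
    by (simp add: contraction_semigroup_def)
  then show ?thesis by (simp add: A_def[abs_def])
qed

text \<open>For bounded \<open>A\<close> every orbit is differentiable at 0, so the domain is the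
  whole space.\<close>

lemma infinitesimal_generator_exp_orbit:
  assumes "bounded_linear A"
  shows "infinitesimal_generator (exp_orbit A) UNIV A"
proof -
  have "((\<lambda>h. (exp_orbit A h x - x) /\<^sub>R h) \<longlongrightarrow> A x) (at_right 0)" for x
  proof -
    have "((\<lambda>h. exp_orbit A h x) has_vector_derivative A x) (at 0)"
      using exp_orbit_has_vector_derivative[OF assms, of x 0] by simp
    then have "((\<lambda>h. exp_orbit A h x) has_vector_derivative A x) (at_right 0)"
      by (rule has_vector_derivative_at_within)
    then have lim: "((\<lambda>h. (1 / norm h) *\<^sub>R (exp_orbit A h x - (x + h *\<^sub>R A x))) \<longlongrightarrow> 0) (at_right 0)"
      by (simp add: has_vector_derivative_def has_derivative_within)
    \<comment> \<open>For \<open>h > 0\<close> the norm of \<open>h\<close> is \<open>h\<close>, so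
      the normalised remainder is the difference quotient minus \<open>A x\<close>.\<close>
    have "\<forall>\<^sub>F h in at_right 0. (1 / norm h) *\<^sub>R (exp_orbit A h x - (x + h *\<^sub>R A x))
        = (exp_orbit A h x - x) /\<^sub>R h - A x"
      using eventually_at_right_less[of "0::real"]
      by eventually_elim (simp add: algebra_simps divide_inverse_commute)
    from Lim_transform_eventually[OF lim this]
    have "((\<lambda>h. (exp_orbit A h x - x) /\<^sub>R h - A x) \<longlongrightarrow> 0) (at_right 0)" .
    then show ?thesis by (rule LIM_zero_cancel)
  qed
  then show ?thesis by (auto simp: infinitesimal_generator_def)
qed

theorem theorem4p1:
  fixes \<mu> :: "real measure" and H :: "ell2 \<Rightarrow> ell2"
  assumes "finite_borel_measure_01 \<mu>"
    and "bounded_clinear H" and "has_matrix H (hankel_matrix \<mu>)"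
  shows "numerical_range H \<subseteq> {z. Re z \<ge> 0} \<and>
    spectrum H \<subseteq> {z. Re z \<ge> 0} \<and>
    (\<exists>S. contraction_semigroup S \<and> infinitesimal_generator S UNIV (\<lambda>x. - H x))"
proof (intro conjI exI)
  \<comment> \<open>All three claims rest on this inequality; for the numerical range,
    \<open>inner\<close> is the real part of \<open>cinner\<close>.\<close>
  have pos: "0 \<le> inner (H x) x" for x
    using assms by (rule inner_hankel_nonneg)
  show "numerical_range H \<subseteq> {z. Re z \<ge> 0}"
    using pos by (auto simp: numerical_range_def inner_ell2_def)
  show "spectrum H \<subseteq> {z. Re z \<ge> 0}"
    using assms(2) pos by (rule spectrum_accretive)
  show "contraction_semigroup (exp_orbit (\<lambda>x. - H x))"
    using assms(2) pos by (rule contraction_semigroup_exp_orbit)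
  show "infinitesimal_generator (exp_orbit (\<lambda>x. - H x)) UNIV (\<lambda>x. - H x)"
    using assms(2)
    by (intro infinitesimal_generator_exp_orbit bounded_linear_minus) (simp add: bounded_clinear_def)
qed

end
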